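(* Let $L$ be a finite join-semidistributive lattice. If $L$ is shellable, then $L$ is join-extremal. Thus, if $L$ is a finite semidistributive lattice and $L$ is shellable, then $L$ is extremal.
   Context: All posets and lattices are finite, and lattices are nonempty. A poset $L$ is a lattice if every pair $\{x,y\}\subseteq L$ has a greatest lower bound (meet) $x\wedge y$ and a least upper bound (join) $x\vee y$. Semidistributivity. A lattice $L$ is join-semidistributive if, for all $x,y,z\in L$, the equality $x\vee y=x\vee z$ implies $x\vee(y\wedge z)=x\vee y$. Dually, $L$ is meet-semidistributive if, for all $x,y,z\in L$, the equality $x\wedge y=x\wedge z$ implies $x\wedge(y\vee z)=x\wedge y$. $L$ is semidistributive if it is both join-semidistributive and meet-semidistributive. Shellability. A chain of a poset $P$ is a totally ordered subset; it is maximal if it is not a proper subset of a larger chain. The order complex $\Delta(P)$ is the simplicial complex on vertex set $P$ whose faces are the chains of $P$; its facets are the maximal chains of $P$. A simplicial complex (not necessarily pure) is shellable if there is a linear order $F_1,F_2,\dots,F_k$ of its facets such that for all $1\leq i<j\leq k$ there exists $l<j$ with $F_i\cap F_j\subseteq F_l\cap F_j$ and $|F_l\cap F_j|=|F_j|-1$. A poset $P$ is shellable if $\Delta(P)$ is shellable. Extremality. For $x,y$ in a poset, $y$ covers $x$ if $x<y$ and there is no $z$ with $x<z<y$. An element of $L$ is join-irreducible if it covers exactly one element, and meet-irreducible if it is covered by exactly one element; $\mathrm{JIrr}(L)$ and $\mathrm{MIrr}(L)$ denote the sets of join-irreducible and meet-irreducible elements of $L$. The length of a chain is its number of elements minus one,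 and $\ell(L)$ is the maximal length of a chain of $L$. The lattice $L$ is join-extremal if $\ell(L)=|\mathrm{JIrr}(L)|$, meet-extremal if $\ell(L)=|\mathrm{MIrr}(L)|$, and extremal if it is both join-extremal and meet-extremal. *)

theory Defs
  imports Main
begin

text \<open>
  A finite nonempty lattice is modelled as a type of sort \<open>{finite, lattice}\<close> (types are nonempty);
  properties of the lattice as a whole take an argument \<open>TYPE('a)\<close>.
  The order-theoretic notions are defined inside the type classes, so that they can also be
  interpreted for the dual order.
\<close>

section \<open>Shellability\<close>

definition facets :: "'v set set \<Rightarrow> 'v set set" where
  "facets K = {F \<in> K. \<forall>G \<in> K. F \<subseteq> G \<longrightarrow> G = F}"

text \<open>
  Non-pure shellability; a linear order of the finitely many facets is a duplicate-free list.
  The condition \<open>card (F\<^sub>l \<inter> F\<^sub>j) = card F\<^sub>j - 1\<close> is written without subtraction.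
\<close>

definition shelling :: "'v set set \<Rightarrow> 'v set list \<Rightarrow> bool" where
  "shelling K Fs \<longleftrightarrow> distinct Fs \<and> set Fs = facets K \<and>
     (\<forall>j < length Fs. \<forall>i < j. \<exists>l < j.
        Fs ! i \<inter> Fs ! j \<subseteq> Fs ! l \<inter> Fs ! j \<and>
        card (Fs ! l \<inter> Fs ! j) + 1 = card (Fs ! j))"

definition shellable_complex :: "'v set set \<Rightarrow> bool" where
  "shellable_complex K \<longleftrightarrow> (\<exists>Fs. shelling K Fs)"

context order
begin

definition order_complex :: "'a set set" where
  "order_complex = {C. Complete_Partial_Order.chain (\<le>) C}"

definition shellable :: "'a itself \<Rightarrow> bool" where
  "shellable _ \<longleftrightarrow> shellable_complex (order_complex :: 'a set set)"

end


section \<open>Semidistributivity\<close>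

context lattice
begin

definition join_semidistributive :: "'a itself \<Rightarrow> bool" where
  "join_semidistributive _ \<longleftrightarrow>
     (\<forall>x y z :: 'a. sup x y = sup x z \<longrightarrow> sup x (inf y z) = sup x y)"

definition meet_semidistributive :: "'a itself \<Rightarrow> bool" where
  "meet_semidistributive _ \<longleftrightarrow>
     (\<forall>x y z :: 'a. inf x y = inf x z \<longrightarrow> inf x (sup y z) = inf x y)"

definition semidistributive :: "'a itself \<Rightarrow> bool" where
  "semidistributive T \<longleftrightarrow> join_semidistributive T \<and> meet_semidistributive T"

end


section \<open>Extremality\<close>

context order
begin

definition covers :: "'a \<Rightarrow> 'a \<Rightarrow> bool" where
  "covers y x \<longleftrightarrow> x < y \<and> \<not> (\<exists>z. x < z \<and> z < y)"

definition JIrr :: "'a set" where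
  "JIrr = {x. \<exists>!y. covers x y}"

definition MIrr :: "'a set" where
  "MIrr = {x. \<exists>!y. covers y x}"

text \<open>
  Meaningful for finite orders. The empty chain contributes \<open>0 - 1 = 0\<close> (on \<^typ>\<open>nat\<close>), which is
  the length of a singleton chain and hence does not affect the maximum.
\<close>

definition max_chain_length :: "'a itself \<Rightarrow> nat" where
  "max_chain_length _ = Max {card C - 1 | C :: 'a set. Complete_Partial_Order.chain (\<le>) C}"

end

context lattice
begin

definition join_extremal :: "'a itself \<Rightarrow> bool" where
  "join_extremal T \<longleftrightarrow> max_chain_length T = card (JIrr :: 'a set)"

definition meet_extremal :: "'a itself \<Rightarrow> bool" where
  "meet_extremal T \<longleftrightarrow> max_chain_length T = card (MIrr :: 'a set)"

definition extremal :: "'a itself \<Rightarrow> bool" where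
  "extremal T \<longleftrightarrow> join_extremal T \<and> meet_extremal T"

end

end

(*
  In a join-semidistributive lattice every cover x < y has a label: the least z with sup x z = y.
  The labels on a maximal chain are distinct, and every join-irreducible element j is the label of
  the edge below it.  If two maximal chains F and F' satisfy F \<inter> F' = F - {v}, then every label
  of F is also a label of F'.  Following a shelling backwards, the first facet therefore carries
  all join-irreducible elements as labels, so its length is at least their number; the converse
  inequality holds in any finite lattice.  The statement for semidistributive lattices follows by
  applying this to the dual order, which has the same order complex.
*)
theory Submission
  imports Defs
begin

context lattice
begin

section \<open>Edge labels and facets of the order complex\<close>

text \<open>A relation rather than a function: without join-semidistributivity a cover may have no
  label. Antisymmetry makes the label unique.\<close>

definition edge_label :: "'a \<Rightarrow> 'a \<Rightarrow> 'a \<Rightarrow> bool" where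
  "edge_label j x y \<longleftrightarrow> covers y x \<and> sup x j = y \<and> (\<forall>z. sup x z = y \<longrightarrow> j \<le> z)"

definition chain_labels :: "'a set \<Rightarrow> 'a set" where
  "chain_labels C = {j. \<exists>x\<in>C. \<exists>y\<in>C. edge_label j x y}"

lemma mem_facet_order_complexI:
  assumes "F \<in> facets order_complex" "\<And>y. y \<in> F \<Longrightarrow> x \<le> y \<or> y \<le> x"
  shows "x \<in> F"
proof -
  have "Complete_Partial_Order.chain (\<le>) F"
    using assms(1) by (simp add: facets_def order_complex_def)
  then have "Complete_Partial_Order.chain (\<le>) (insert x F)"
    using assms(2) unfolding Complete_Partial_Order.chain_def by blast
  then have "insert x F = F"
    using assms(1) unfolding facets_def order_complex_def by blast
  then show ?thesis by blast
qed

lemma facet_order_complex_linear: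
  assumes "F \<in> facets order_complex" "x \<in> F" "y \<in> F"
  shows "x \<le> y \<or> y \<le> x"
  using assms by (auto simp: facets_def order_complex_def Complete_Partial_Order.chain_def)

lemma coversD:
  assumes "covers y x" "x \<le> z" "z \<le> y"
  shows "z = x \<or> z = y"
  using assms unfolding covers_def by (metis local.order.order_iff_strict)

text \<open>Finiteness is a local assumption instead of a sort constraint, so that the results can
  be instantiated for the dual order.\<close>

context
  assumes fin: "finite (UNIV :: 'a set)"
begin

lemma fin_set: "finite (A :: 'a set)"
  by (rule finite_subset[OF subset_UNIV fin])

text \<open>Take the largest element of \<open>F\<close> below \<open>w\<close>. Anything strictly
  between it and \<open>w\<close> is comparable with all of \<open>F\<close>, hence lies in
  \<open>F\<close> by maximality. So consecutive elements of a facet form covers of the whole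
  lattice.\<close>

lemma facet_pred:
  assumes F: "F \<in> facets order_complex" and w: "w \<in> F" and u: "u \<in> F" "u < w"
  obtains p where "p \<in> F" "covers w p" "u \<le> p"
proof -
  have "{z \<in> F. z < w} \<noteq> {}"
    using u by auto
  then obtain p where p: "p \<in> {z \<in> F. z < w}"
    and max: "\<forall>z \<in> {z \<in> F. z < w}. p \<le> z \<longrightarrow> p = z"
    using finite_has_maximal[OF fin_set] by meson
  have le: "z \<le> p" if "z \<in> F" "z < w" for z
    using max that p facet_order_complex_linear[OF F] by blast
  have "\<not> (\<exists>z. p < z \<and> z < w)"
  proof
    assume "\<exists>z. p < z \<and> z < w"
    then obtain z where z: "p < z" "z < w" by blast
    have "z \<in> F"
    proof (rule mem_facet_order_complexI[OF F])
      fix y assume y: "y \<in> F"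
      show "z \<le> y \<or> y \<le> z"
        using facet_order_complex_linear[OF F y w] le[OF y] z
        by (metis local.less_imp_le local.order.trans local.order.order_iff_strict)
    qed
    with le z show False by (meson local.leD)
  qed
  with p have "covers w p" by (simp add: covers_def)
  with p le u that show ?thesis by blast
qed

lemma facet_succ:
  assumes F: "F \<in> facets order_complex" and u: "u \<in> F" and w: "w \<in> F" "u < w"
  obtains p where "p \<in> F" "covers p u" "p \<le> w"
proof -
  have "{z \<in> F. u < z} \<noteq> {}"
    using w by auto
  then obtain p where p: "p \<in> {z \<in> F. u < z}"
    and min: "\<forall>z \<in> {z \<in> F. u < z}. z \<le> p \<longrightarrow> p = z"
    using finite_has_minimal[OF fin_set] by meson
  have le: "p \<le> z" if "z \<in> F" "u < z" for z
    using min that p facet_order_complex_linear[OF F] by blast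
  have "\<not> (\<exists>z. u < z \<and> z < p)"
  proof
    assume "\<exists>z. u < z \<and> z < p"
    then obtain z where z: "u < z" "z < p" by blast
    have "z \<in> F"
    proof (rule mem_facet_order_complexI[OF F])
      fix y assume y: "y \<in> F"
      show "z \<le> y \<or> y \<le> z"
        using facet_order_complex_linear[OF F y u] le[OF y] z
        by (metis local.less_imp_le local.order.trans local.order.order_iff_strict)
    qed
    with le z show False by (meson local.leD)
  qed
  with p have "covers p u" by (simp add: covers_def)
  with p le w that show ?thesis by blast
qed

text \<open>Bottom and top lie in every facet, so an exchanged element is neither and has neighbours
  in \<open>F\<close> on both sides.\<close>

lemma facet_diff_not_extreme:
  assumes F: "F \<in> facets order_complex" and F': "F' \<in> facets order_complex"
    and v: "v \<in> F" "v \<notin> F'"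
  shows "\<exists>z\<in>F. z < v" "\<exists>z\<in>F. v < z"
proof -
  define b t where "b = Inf_fin (UNIV :: 'a set)" and "t = Sup_fin (UNIV :: 'a set)"
  have b: "b \<le> z" and t: "z \<le> t" for z
    using fin by (auto simp: b_def t_def intro: Inf_fin.coboundedI Sup_fin.coboundedI)
  have mem: "b \<in> G" "t \<in> G" if "G \<in> facets order_complex" for G
    using mem_facet_order_complexI[OF that] b t by blast+
  have "b \<noteq> v" "t \<noteq> v"
    using mem[OF F'] v by blast+
  then have "b < v" "v < t"
    using b[of v] t[of v] by (simp_all add: local.less_le)
  with mem[OF F] show "\<exists>z\<in>F. z < v" "\<exists>z\<in>F. v < z" by blast+
qed

lemma facet_exists:
  assumes "Complete_Partial_Order.chain (\<le>) C"
  obtains F where "F \<in> facets order_complex" "C \<subseteq> F"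
proof -
  have "finite (order_complex :: 'a set set)"
    by (rule finite_subset[OF _ finite_Pow_iff[THEN iffD2, OF fin]]) simp
  moreover have "C \<in> order_complex" using assms by (simp add: order_complex_def)
  ultimately obtain F where "F \<in> order_complex" "C \<subseteq> F"
    "\<forall>G \<in> order_complex. F \<subseteq> G \<longrightarrow> F = G"
    using order_class.finite_has_maximal2[of "order_complex :: 'a set set" C] by blast
  with that show ?thesis unfolding facets_def by blast
qed

section \<open>Existence of labels; join-irreducibles as labels\<close>

text \<open>Join-semidistributivity closes the solutions \<open>z\<close> of
  \<open>sup x z = y\<close> under meets, so a minimal solution is the least one.\<close>

lemma edge_label_exists:
  assumes jsd: "join_semidistributive TYPE('a)" and cov: "covers y x"
  obtains j where "edge_label j x y"
proof -
  have "y \<in> {z. sup x z = y}" using cov by (auto simp: covers_def sup_absorb2)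
  then obtain m where m: "sup x m = y" and min: "\<And>z. sup x z = y \<Longrightarrow> z \<le> m \<Longrightarrow> m = z"
    using finite_has_minimal[OF fin_set, of "{z. sup x z = y}"] by blast
  have "m \<le> z" if "sup x z = y" for z
  proof -
    have "sup x (inf m z) = y"
      using jsd m that unfolding join_semidistributive_def by metis
    then have "m = inf m z" using min by simp
    then show ?thesis by (metis inf_le2)
  qed
  with m cov that show ?thesis unfolding edge_label_def by blast
qed

lemma edge_label_JIrr:
  assumes "j \<in> JIrr"
  obtains k where "edge_label j k j"
proof -
  obtain k where k: "covers j k" and uniq: "\<And>y. covers j y \<Longrightarrow> y = k"
    using assms unfolding JIrr_def by blast
  \<comment> \<open>By finiteness \<open>z\<close> lies below some lower cover of \<open>j\<close>,
    and \<open>k\<close> is the only one.\<close>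
  have below: "z \<le> k" if "z < j" for z
  proof -
    from that have "z \<in> {y. y < j}" by simp
    from finite_has_maximal2[OF fin_set this]
    obtain c where c: "c < j" "z \<le> c" and "\<forall>y\<in>{y. y < j}. c \<le> y \<longrightarrow> c = y"
      by blast
    then have "covers j c" unfolding covers_def by (metis local.less_imp_le local.less_irrefl mem_Collect_eq)
    with c uniq show ?thesis by blast
  qed
  have lt: "k < j" using k by (simp add: covers_def)
  have "j \<le> z" if "sup k z = j" for z
  proof (rule ccontr)
    assume "\<not> j \<le> z"
    moreover have "z \<le> j" using that sup_ge2 by blast
    ultimately have "z < j" by (simp add: local.less_le_not_le)
    then have "sup k z = k" using below by (simp add: sup_absorb1)
    with that lt show False by simp
  qed
  with k lt have "edge_label j k j"
    by (simp add: edge_label_def sup_absorb2)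
  with that show ?thesis by blast
qed

section \<open>Labels under exchange of one chain element\<close>

text \<open>Two routes lead from \<open>u\<close> to \<open>w\<close>, one through \<open>v\<close>
  and one ending with the edge \<open>p < w\<close>. The first label of the route through
  \<open>v\<close> reappears on the last edge of the other, because \<open>sup p v = w\<close> and
  \<open>v = sup u a\<close> with \<open>u\<close> below \<open>p\<close>.\<close>

lemma edge_label_upper_right:
  assumes jsd: "join_semidistributive TYPE('a)"
    and a: "edge_label a u v" and vw: "covers w v" and pw: "covers w p"
    and up: "u \<le> p" and ne: "p \<noteq> v"
  shows "edge_label a p w"
proof -
  have uv: "covers v u" and ua: "sup u a = v" and amin: "\<And>z. sup u z = v \<Longrightarrow> a \<le> z"
    using a unfolding edge_label_def by auto
  have lt: "u < v" "v < w" "p < w" using uv vw pw by (auto simp: covers_def)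
  have "\<not> p \<le> v"
  proof
    assume "p \<le> v"
    then have "p = u" using coversD[OF uv up] ne by blast
    then show False using pw lt by (auto simp: covers_def)
  qed
  then have "sup p v = w"
    using coversD[OF vw, of "sup p v"] lt
    by (metis local.less_imp_le local.sup_ge1 local.sup_ge2 local.sup_least)
  then have pa: "sup p a = w" using ua up by (metis local.sup.absorb1 local.sup_assoc)
  have "a \<le> z" if "sup p z = w" for z
  proof -
    \<comment> \<open>Since \<open>c\<close> is below \<open>a\<close>, \<open>sup u c\<close> is
      \<open>u\<close> or \<open>v\<close>. The value \<open>u\<close> would put \<open>c\<close>
      below \<open>p\<close>, contradicting \<open>sup p c = w\<close>; the value \<open>v\<close>
      gives \<open>a\<close> below \<open>c\<close>, hence below \<open>z\<close>.\<close>
    define c where "c = inf a z"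
    have pc: "sup p c = w"
      using jsd pa that unfolding join_semidistributive_def c_def by metis
    have "sup u c \<le> v" using ua unfolding c_def
      by (metis local.inf_le1 local.order_refl local.sup_mono)
    then consider "sup u c = u" | "sup u c = v" using coversD[OF uv] by (metis sup_ge1)
    then show ?thesis
    proof cases
      case 1
      then have "c \<le> p" using up by (metis local.order.trans local.sup_ge2)
      with pc lt show ?thesis by (simp add: sup_absorb1)
    next
      case 2
      then show ?thesis using amin c_def by (metis local.inf.bounded_iff)
    qed
  qed
  with pa pw show ?thesis by (simp add: edge_label_def)
qed

text \<open>The companion move: the upper label \<open>b\<close> descends to the first edge
  \<open>u < p\<close> of the other route. From \<open>sup v p = w\<close> follows that
  \<open>b\<close> is below \<open>p\<close>. Minimality is inherited because joining
  \<open>v\<close> to \<open>sup u z = p\<close> yields \<open>sup v z = w\<close>.\<close>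

lemma edge_label_lower_left:
  assumes b: "edge_label b v w" and uv: "covers v u" and pu: "covers p u"
    and pw: "p \<le> w" and ne: "p \<noteq> v"
  shows "edge_label b u p"
proof -
  have vw: "covers w v" and vb: "sup v b = w" and bmin: "\<And>z. sup v z = w \<Longrightarrow> b \<le> z"
    using b unfolding edge_label_def by auto
  have lt: "u < v" "v < w" "u < p" using uv vw pu by (auto simp: covers_def)
  have "\<not> p \<le> v" using coversD[OF uv, of p] ne lt by (auto dest: local.less_imp_le)
  then have vp: "sup v p = w"
    using coversD[OF vw, of "sup v p"] lt pw
    by (metis local.less_imp_le local.sup_ge1 local.sup_ge2 local.sup_least)
  then have "b \<le> p" using bmin by blast
  then have "sup u b \<le> p" using lt by simp
  moreover have "sup u b \<noteq> u"
  proof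
    assume "sup u b = u"
    then have "b \<le> v" using lt by (metis local.less_imp_le local.order.trans local.sup_ge2)
    then show False using vb lt by (simp add: sup_absorb1)
  qed
  ultimately have "sup u b = p" using coversD[OF pu] by (metis sup_ge1)
  moreover have "b \<le> z" if "sup u z = p" for z
    using bmin that vp lt by (metis local.less_imp_le local.sup.absorb1 local.sup_assoc)
  ultimately show ?thesis using pu by (simp add: edge_label_def)
qed

text \<open>Only the two edges of \<open>F\<close> at \<open>v\<close> can be lost. The label below
  \<open>v\<close> moves to the last edge of \<open>F'\<close> under \<open>w\<close>, the label
  above \<open>v\<close> to the first edge of \<open>F'\<close> over \<open>u\<close>. Between
  \<open>u\<close> and \<open>w\<close>, \<open>F'\<close> may be longer than \<open>F\<close>, so
  only an inclusion is claimed.\<close>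

lemma chain_labels_subset_adjacent_facet:
  assumes jsd: "join_semidistributive TYPE('a)"
    and F: "F \<in> facets order_complex" and F': "F' \<in> facets order_complex"
    and v: "v \<in> F" "v \<notin> F'" and sub: "F - {v} \<subseteq> F'"
  shows "chain_labels F \<subseteq> chain_labels F'"
proof
  fix a assume "a \<in> chain_labels F"
  then obtain x y where xy: "x \<in> F" "y \<in> F" "edge_label a x y"
    unfolding chain_labels_def by blast
  have lt: "x < y" using xy by (auto simp: edge_label_def covers_def)
  obtain u where u: "u \<in> F" "covers v u"
    using facet_diff_not_extreme(1)[OF F F' v] facet_pred[OF F v(1)] by blast
  obtain w where w: "w \<in> F" "covers w v"
    using facet_diff_not_extreme(2)[OF F F' v] facet_succ[OF F v(1)] by blast
  have uvw: "u < v" "v < w" using u w by (auto simp: covers_def)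
  have uw: "u \<in> F'" "w \<in> F'" "u < w" using u w sub uvw by auto
  consider "y = v" | "x = v" | "x \<noteq> v" "y \<noteq> v" by blast
  then show "a \<in> chain_labels F'"
  proof cases
    case 1
    have x: "x \<in> F'" "x < w" using xy sub lt 1 uvw by auto
    obtain p where p: "p \<in> F'" "covers w p" "x \<le> p"
      using facet_pred[OF F' uw(2) x] by blast
    then have "edge_label a p w"
      using edge_label_upper_right[OF jsd _ w(2)] xy 1 v by blast
    then show ?thesis using p uw unfolding chain_labels_def by blast
  next
    case 2
    have y: "y \<in> F'" "u < y" using xy sub lt 2 uvw by auto
    obtain p where p: "p \<in> F'" "covers p u" "p \<le> y"
      using facet_succ[OF F' uw(1) y] by blast
    then have "edge_label a u p"
      using edge_label_lower_left[OF _ u(2)] xy 2 v by blast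
    then show ?thesis using p uw unfolding chain_labels_def by blast
  next
    case 3
    then show ?thesis using xy sub unfolding chain_labels_def by blast
  qed
qed

section \<open>Counting labels and join-irreducibles\<close>

text \<open>Send each label to the upper end of a chosen edge carrying it. An element of a facet has
  at most one lower cover in it, so this map is injective, and it misses the minimum.\<close>

lemma card_chain_labels_le:
  assumes F: "F \<in> facets order_complex"
  shows "card (chain_labels F) \<le> card F - 1"
proof (cases "F = {}")
  case True
  then show ?thesis by (simp add: chain_labels_def)
next
  case False
  then obtain m where m: "m \<in> F" and min: "\<forall>z\<in>F. z \<le> m \<longrightarrow> m = z"
    using finite_has_minimal[OF fin_set] by blast
  have "\<exists>f. \<forall>j\<in>chain_labels F. f j \<in> F \<and> (\<exists>x\<in>F. edge_label j x (f j))"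
    by (rule bchoice) (auto simp: chain_labels_def)
  then obtain f where f: "\<And>j. j \<in> chain_labels F \<Longrightarrow> f j \<in> F \<and> (\<exists>x\<in>F. edge_label j x (f j))"
    by blast
  have "inj_on f (chain_labels F)"
  proof (rule inj_onI)
    fix i j assume ij: "i \<in> chain_labels F" "j \<in> chain_labels F" "f i = f j"
    obtain x y where x: "x \<in> F" "edge_label i x (f i)" and y: "y \<in> F" "edge_label j y (f i)"
      using f ij by metis
    have "x = y"
      using facet_order_complex_linear[OF F x(1) y(1)] x(2) y(2)
      unfolding edge_label_def covers_def by (metis local.order.order_iff_strict)
    then show "i = j" using x y unfolding edge_label_def by (meson local.order.antisym)
  qed
  moreover have "f ` chain_labels F \<subseteq> F - {m}"
  proof
    fix y assume "y \<in> f ` chain_labels F"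
    then obtain x j where "y \<in> F" "x \<in> F" "edge_label j x y" using f by blast
    moreover then have "x < y" by (auto simp: edge_label_def covers_def)
    ultimately show "y \<in> F - {m}"
      using min by force
  qed
  ultimately have "card (chain_labels F) \<le> card (F - {m})"
    using card_inj_on_le fin_set by blast
  with m show ?thesis by (simp add: fin_set)
qed

text \<open>Choose \<open>j\<close> minimal among the elements not below \<open>x\<close>, starting
  from \<open>y\<close>. Everything strictly below \<open>j\<close> is then below
  \<open>inf j x\<close>, which is therefore its unique lower cover.\<close>

lemma JIrr_separates:
  assumes "\<not> y \<le> x"
  obtains j where "j \<in> JIrr" "j \<le> y" "\<not> j \<le> x"
proof -
  obtain j where j: "j \<le> y" "\<not> j \<le> x"
    and min: "\<And>z. \<not> z \<le> x \<Longrightarrow> z \<le> j \<Longrightarrow> j = z"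
    using finite_has_minimal2[OF fin_set, of y "{z. \<not> z \<le> x}"] assms by auto
  have below: "z \<le> inf j x" if "z < j" for z
    using min[of z] that local.less_imp_le[of z j] by auto
  have lt: "inf j x < j" using j by (metis local.inf_le1 local.inf_le2 local.order.order_iff_strict)
  have "covers j (inf j x)"
    using lt below unfolding covers_def by (meson local.leD)
  moreover have "z = inf j x" if "covers j z" for z
    using that below lt unfolding covers_def by (meson local.order.order_iff_strict)
  ultimately have "j \<in> JIrr" unfolding JIrr_def by blast
  with j that show ?thesis by blast
qed

lemma card_chain_le_JIrr:
  assumes C: "Complete_Partial_Order.chain (\<le>) C"
  shows "card C - 1 \<le> card (JIrr :: 'a set)"
proof -
  \<comment> \<open>\<open>r\<close> is strictly increasing with values from 0 to the number of
    join-irreducibles, which leaves room for one element more than that number.\<close>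
  define r where "r x = card {j \<in> JIrr. j \<le> x}" for x :: 'a
  have mono: "r x < r y" if "x < y" for x y
  proof -
    have le: "x \<le> y" and nle: "\<not> y \<le> x"
      using that by (simp_all add: local.less_le_not_le)
    obtain j where "j \<in> JIrr" "j \<le> y" "\<not> j \<le> x"
      using nle by (rule JIrr_separates)
    moreover have "{j \<in> JIrr. j \<le> x} \<subseteq> {j \<in> JIrr. j \<le> y}"
      using le by (auto intro: local.order.trans)
    ultimately have "{j \<in> JIrr. j \<le> x} \<subset> {j \<in> JIrr. j \<le> y}" by blast
    then show ?thesis unfolding r_def by (rule psubset_card_mono[OF fin_set])
  qed
  have "inj_on r C"
  proof (rule inj_onI)
    fix x y assume "x \<in> C" "y \<in> C" "r x = r y"
    then show "x = y"
      using C mono[of x y] mono[of y x]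
      by (auto simp: Complete_Partial_Order.chain_def local.le_less)
  qed
  moreover have "r ` C \<subseteq> {..card (JIrr :: 'a set)}"
    unfolding r_def by (auto intro: card_mono fin_set)
  ultimately have "card C \<le> card {..card (JIrr :: 'a set)}"
    by (metis card_inj_on_le finite_atMost)
  then show ?thesis by simp
qed

section \<open>From shellings to extremality\<close>

lemma shelling_JIrr_subset_first_facet:
  assumes jsd: "join_semidistributive TYPE('a)" and sh: "shelling (order_complex :: 'a set set) Fs"
  shows "Fs \<noteq> [] \<and> (JIrr :: 'a set) \<subseteq> chain_labels (Fs ! 0)"
proof -
  have set: "set Fs = facets order_complex" using sh by (simp add: shelling_def)
  have sub: "chain_labels (Fs ! k) \<subseteq> chain_labels (Fs ! 0)" if "k < length Fs" for k
    using that
  proof (induction k rule: less_induct)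
    case (less k)
    show ?case
    proof (cases "k = 0")
      case False
      \<comment> \<open>As \<open>k\<close> is nonzero, some earlier index exists to which the
        shelling condition applies. The resulting \<open>Fs ! l\<close> misses exactly one element
        of \<open>Fs ! k\<close>.\<close>
      then obtain l where l: "l < k" "card (Fs ! l \<inter> Fs ! k) + 1 = card (Fs ! k)"
        using sh less.prems unfolding shelling_def by blast
      have "card (Fs ! k - Fs ! l) = 1"
        using l card_Diff_subset_Int[OF fin_set, of "Fs ! k" "Fs ! l"]
        by (simp add: Int_commute)
      then obtain v where v: "Fs ! k - Fs ! l = {v}" using card_1_singletonE by blast
      have "Fs ! k \<in> facets order_complex" "Fs ! l \<in> facets order_complex"
        using nth_mem[of k Fs] nth_mem[of l Fs] less.prems l(1) unfolding set by simp_all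
      then have "chain_labels (Fs ! k) \<subseteq> chain_labels (Fs ! l)"
        using chain_labels_subset_adjacent_facet[OF jsd, of "Fs ! k" "Fs ! l" v]
          v by blast
      also have "\<dots> \<subseteq> chain_labels (Fs ! 0)"
        using less.IH l(1) less.prems by simp
      finally show ?thesis .
    qed simp
  qed
  have "j \<in> chain_labels (Fs ! 0)" if "j \<in> JIrr" for j
  proof -
    obtain k where k: "edge_label j k j" using edge_label_JIrr \<open>j \<in> JIrr\<close> by blast
    then have "Complete_Partial_Order.chain (\<le>) {k, j}"
      by (auto simp: edge_label_def covers_def Complete_Partial_Order.chain_def)
    then obtain F where "F \<in> facets order_complex" "{k, j} \<subseteq> F"
      using facet_exists by blast
    then have "j \<in> chain_labels F" "F \<in> set Fs"
      using k set unfolding chain_labels_def by auto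
    with sub show ?thesis by (metis in_set_conv_nth subsetD)
  qed
  moreover have "Fs \<noteq> []"
    \<comment> \<open>A facet containing the empty chain shows that \<open>Fs ! 0\<close> is a
      genuine entry.\<close>
    using facet_exists[of "{}"] set by (metis Complete_Partial_Order.chain_empty empty_iff list.set(1))
  ultimately show ?thesis by blast
qed

lemma join_extremal_if_shellable:
  assumes jsd: "join_semidistributive TYPE('a)" and "shellable TYPE('a)"
  shows "join_extremal TYPE('a)"
proof -
  obtain Fs where Fs: "shelling (order_complex :: 'a set set) Fs"
    using assms by (auto simp: shellable_def shellable_complex_def)
  let ?F = "Fs ! 0"
  have ne: "Fs \<noteq> []" and sub: "(JIrr :: 'a set) \<subseteq> chain_labels ?F"
    using shelling_JIrr_subset_first_facet[OF jsd Fs] by auto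
  have F: "?F \<in> facets order_complex" using Fs ne unfolding shelling_def
    by (metis length_greater_0_conv nth_mem)
  then have ch: "Complete_Partial_Order.chain (\<le>) ?F"
    by (simp add: facets_def order_complex_def)
  have "card (JIrr :: 'a set) \<le> card ?F - 1"
    using card_mono[OF fin_set sub] card_chain_labels_le[OF F] by simp
  \<comment> \<open>The first facet attains the upper bound valid for all chains, so it realises the
    maximum.\<close>
  with card_chain_le_JIrr[OF ch] have eq: "card ?F - 1 = card (JIrr :: 'a set)" by simp
  let ?S = "{card C - 1 | C :: 'a set. Complete_Partial_Order.chain (\<le>) C}"
  have "finite ?S"
    by (rule finite_subset[of _ "{..card (JIrr :: 'a set)}"]) (auto dest: card_chain_le_JIrr)
  moreover have "card (JIrr :: 'a set) \<in> ?S" using ch eq by (metis (mono_tags, lifting) mem_Collect_eq)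
  ultimately have "Max ?S = card (JIrr :: 'a set)"
    using card_chain_le_JIrr by (intro Max_eqI) auto
  then show ?thesis by (simp add: join_extremal_def max_chain_length_def)
qed

end

text \<open>Reversing the order keeps the chains, hence the order complex and the lengths, while
  covers flip and so turn \<open>JIrr\<close> into \<open>MIrr\<close>.\<close>

lemma meet_extremal_if_shellable:
  assumes fin: "finite (UNIV :: 'a set)"
    and msd: "meet_semidistributive TYPE('a)" and sh: "shellable TYPE('a)"
  shows "meet_extremal TYPE('a)"
proof -
  have ord: "class.order (\<ge>) (>)" by (rule dual_order)
  have lat: "class.lattice sup (\<ge>) (>) inf" by (rule dual_lattice)
  have chain: "Complete_Partial_Order.chain (\<ge>) = Complete_Partial_Order.chain (\<le>)"
    by (auto simp: Complete_Partial_Order.chain_def fun_eq_iff)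
  have covers: "order.covers (>) y x = covers x y" for x y
    unfolding order.covers_def[OF ord] covers_def by auto
  have jirr: "order.JIrr (>) = MIrr"
    unfolding order.JIrr_def[OF ord] MIrr_def covers by simp
  have len: "order.max_chain_length (\<ge>) TYPE('a) = max_chain_length TYPE('a)"
    unfolding order.max_chain_length_def[OF ord] max_chain_length_def chain by simp
  have "lattice.join_semidistributive sup inf TYPE('a)"
    using msd unfolding lattice.join_semidistributive_def[OF lat] meet_semidistributive_def by blast
  moreover have "order.shellable (\<ge>) TYPE('a)"
    using sh unfolding order.shellable_def[OF ord] shellable_def
      order.order_complex_def[OF ord] order_complex_def chain by blast
  ultimately have "lattice.join_extremal (\<ge>) (>) TYPE('a)"
    using lattice.join_extremal_if_shellable[OF lat fin] by blast
  then show ?thesis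
    unfolding lattice.join_extremal_def[OF lat] meet_extremal_def jirr len .
qed

end

theorem theorem1:
  shows "(join_semidistributive TYPE('a :: {finite, lattice}) \<and> shellable TYPE('a)
            \<longrightarrow> join_extremal TYPE('a))
       \<and> (semidistributive TYPE('a) \<and> shellable TYPE('a) \<longrightarrow> extremal TYPE('a))"
  using join_extremal_if_shellable[where 'a = 'a] meet_extremal_if_shellable[where 'a = 'a]
  by (auto simp: semidistributive_def extremal_def)

end
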